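(* For any positive integer $n$, the number of extremely lucky Stirling permutations of order $n$ is the Catalan number $C_n = \frac{1}{n+1}\binom{2n}{n}$.
   Context: A Stirling permutation of order $n$ is a permutation $w = w(1)w(2)\cdots w(2n)$ of the multiset $\{1,1,2,2,\ldots,n,n\}$ such that any value $j$ appearing between the two instances of $i$ satisfies $j>i$. $Q_n$ denotes the set of Stirling permutations of order $n$. Parking interpretation: there is a one-way street with spots $1,\ldots,2n$ (in this order), and cars $1,2,\ldots,2n$ arrive in order, car $i$ having preferred spot $w(i)$. Car $i$ parks in spot $w(i)$ if it is available; otherwise it continues down the street and parks in the first available spot after $w(i)$. For every $w\in Q_n$ all cars park. Car $i$ is lucky if it parks in its preferred spot $w(i)$, and unlucky otherwise. $\mathrm{lucky}(w)$ denotes the number of lucky cars of $w$. A Stirling permutation $w\in Q_n$ is extremely lucky if $\mathrm{lucky}(w)=n$. *)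

theory Defs
  imports Complex_Main "HOL-Combinatorics.Multiset_Permutations"
begin

text \<open>
  The word \<open>w(1) w(2) \<dots> w(2n)\<close> is a list of natural numbers. List positions start at 0,
  so \<open>w(i)\<close> is \<open>w ! (i - 1)\<close>; the letters and the parking spots are numbered from 1.
\<close>

definition stirling_permutations :: "nat \<Rightarrow> nat list set" where
  "stirling_permutations n =
     {w \<in> permutations_of_multiset (mset_set {1..n} + mset_set {1..n}).
        \<forall>a b c. a < b \<and> b < c \<and> c < length w \<and> w ! a = w ! c \<longrightarrow> w ! b > w ! a}"

text \<open>
  The spot taken by a car with preference \<open>p\<close> on a street with spots \<open>1, \<dots>, m\<close> whose
  spots in \<open>occ\<close> are occupied. The result \<open>None\<close> means that the car leaves the
  street without parking; this makes the process total on arbitrary preference lists.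
\<close>
definition parking_spot :: "nat \<Rightarrow> nat set \<Rightarrow> nat \<Rightarrow> nat option" where
  "parking_spot m occ p =
     (if p \<notin> occ \<and> p \<in> {1..m} then Some p
      else if \<exists>s\<in>{1..m}. p < s \<and> s \<notin> occ
      then Some (LEAST s. s \<in> {1..m} \<and> p < s \<and> s \<notin> occ)
      else None)"

primrec park_from :: "nat \<Rightarrow> nat set \<Rightarrow> nat list \<Rightarrow> nat option list" where
  "park_from m occ [] = []"
| "park_from m occ (p # ps) =
     parking_spot m occ p # park_from m (occ \<union> set_option (parking_spot m occ p)) ps"

text \<open>There are as many spots as cars.\<close>
definition parking_outcome :: "nat list \<Rightarrow> nat option list" where
  "parking_outcome w = park_from (length w) {} w"

definition lucky :: "nat list \<Rightarrow> nat" where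
  "lucky w = card {i. i < length w \<and> parking_outcome w ! i = Some (w ! i)}"

definition extremely_lucky :: "nat \<Rightarrow> nat list set" where
  "extremely_lucky n = {w \<in> stirling_permutations n. lucky w = n}"

definition catalan :: "nat \<Rightarrow> real" where
  "catalan n = 1 / (real n + 1) * real ((2 * n) choose n)"

end

theory Submission
  imports Defs "HOL-Computational_Algebra.Formal_Power_Series"
begin

text \<open>
  At most one car per value is lucky, so \<open>w\<close> is extremely lucky iff every spot \<open>s \<le> n\<close> is taken
  by a car preferring it, i.e. iff no car whose preference is a repeated letter \<open>i\<close> ever takes a
  spot \<open>s \<le> n\<close>. This means that all letters \<open>j > i\<close> precede the second \<open>i\<close>, and together with the
  Stirling condition: letters between the two copies of \<open>i\<close> exceed \<open>i\<close>, letters after both are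
  smaller than \<open>i\<close>. Such a word on the letters \<open>i, \<dots>, j - 1\<close> has the form \<open>A i B i\<close> with all letters
  of \<open>A\<close> larger than those of \<open>B\<close>, which yields the Catalan recurrence.
\<close>

section \<open>The Catalan recurrence\<close>

fun catalan_rec :: "nat \<Rightarrow> nat" where
  "catalan_rec 0 = 1"
| "catalan_rec (Suc n) = (\<Sum>k\<le>n. catalan_rec k * catalan_rec (n - k))"

definition catalan_fps :: "real fps" where
  "catalan_fps = Abs_fps (\<lambda>n. real (catalan_rec n))"

lemma catalan_fps_eq: "catalan_fps = 1 + fps_X * catalan_fps\<^sup>2"
proof (rule fps_ext)
  fix n
  have "fps_nth (catalan_fps\<^sup>2) k = real (catalan_rec (Suc k))" for k
    by (simp add: catalan_fps_def power2_eq_square fps_mult_nth atLeast0AtMost)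
  thus "fps_nth catalan_fps n = fps_nth (1 + fps_X * catalan_fps\<^sup>2) n"
    by (cases n) (simp_all add: catalan_fps_def del: catalan_rec.simps(2))
qed

text \<open>Differentiating \<open>F = 1 + X F\<^sup>2\<close> and eliminating \<open>F\<^sup>2\<close> gives a linear differential equation.\<close>
lemma catalan_fps_ode:
  "fps_X * (1 - 4 * fps_X) * fps_deriv catalan_fps = 1 - catalan_fps + 2 * fps_X * catalan_fps"
proof -
  define F where "F = catalan_fps"
  define D where "D = fps_deriv F"
  have F: "F = 1 + fps_X * F\<^sup>2"
    unfolding F_def by (rule catalan_fps_eq)
  have "D = fps_deriv (1 + fps_X * F\<^sup>2)"
    unfolding D_def by (subst F) simp
  also have "\<dots> = F\<^sup>2 + 2 * fps_X * F * D"
    by (simp add: D_def power2_eq_square algebra_simps)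
  finally have D: "D = F\<^sup>2 + 2 * fps_X * F * D" .
  have "fps_X * (1 - 4 * fps_X) * D = 1 - F + 2 * fps_X * F"
    using F D by algebra
  thus ?thesis
    by (simp add: F_def D_def)
qed

text \<open>Comparing the coefficients of \<open>X\<close> to the power \<open>n + 1\<close> in the
  differential equation replaces the convolution by a first-order recurrence, which the central
  binomial coefficients can be tested against.\<close>

lemma catalan_rec_step: "(n + 2) * catalan_rec (Suc n) = (4 * n + 2) * catalan_rec n"
proof -
  have "fps_nth (fps_X * ((1 - 4 * fps_X) * fps_deriv catalan_fps)) (Suc n) =
        fps_nth (1 - catalan_fps + 2 * (fps_X * catalan_fps)) (Suc n)"
    using catalan_fps_ode by (simp add: mult.assoc)
  hence "real (n + 2) * real (catalan_rec (Suc n)) = real (4 * n + 2) * real (catalan_rec n)"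
    by (cases n) (simp_all add: catalan_fps_def algebra_simps numeral_fps_const
        del: catalan_rec.simps(2))
  thus ?thesis
    by (metis of_nat_eq_iff of_nat_mult)
qed

lemma catalan_rec_eq_catalan: "real (catalan_rec n) = catalan n"
proof (induction n)
  case 0
  show ?case by (simp add: catalan_def)
next
  case (Suc n)
  have "(n + 1) * (2 * Suc n choose Suc n) = (4 * n + 2) * (2 * n choose n)"
  proof -
    \<comment> \<open>The extra factor \<open>Suc n\<close> lets the absorption identity be applied
      a second time, after the symmetry of the binomial coefficients; it is cancelled at the
      end.\<close>
    have "Suc n * (Suc n * (2 * Suc n choose Suc n)) =
          Suc n * ((2 * Suc n) * (Suc (2 * n) choose n))"
      using Suc_times_binomial_eq[of "Suc (2 * n)" n] by simp
    also have "\<dots> = (2 * Suc n) * (Suc n * (Suc (2 * n) choose Suc n))"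
      using binomial_symmetric[of n "Suc (2 * n)"] by (simp add: Suc_diff_le)
    also have "Suc n * (Suc (2 * n) choose Suc n) = Suc (2 * n) * (2 * n choose n)"
      using Suc_times_binomial_eq[of "2 * n" n] by simp
    finally have "Suc n * (Suc n * (2 * Suc n choose Suc n)) =
        Suc n * (2 * Suc (2 * n) * (2 * n choose n))"
      by (simp only: mult_ac)
    hence "Suc n * (2 * Suc n choose Suc n) = 2 * Suc (2 * n) * (2 * n choose n)"
      by (simp only: Suc_mult_cancel1)
    moreover have "Suc n = n + 1" "2 * Suc (2 * n) = 4 * n + 2"
      by simp_all
    ultimately show ?thesis
      by (simp only:)
  qed
  hence b: "real (n + 1) * real (2 * Suc n choose Suc n) = real (4 * n + 2) * real (2 * n choose n)"
    by (metis of_nat_mult)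
  have "real (n + 2) * real (catalan_rec (Suc n)) = real (4 * n + 2) * catalan n"
    using catalan_rec_step[of n] Suc.IH by (metis of_nat_mult)
  also have "\<dots> = real (4 * n + 2) * real (2 * n choose n) / real (n + 1)"
    by (simp add: catalan_def)
  also have "\<dots> = real (2 * Suc n choose Suc n)"
    unfolding b[symmetric] by simp
  finally have "real (catalan_rec (Suc n)) = real (2 * Suc n choose Suc n) / real (n + 2)"
    by (simp add: field_simps)
  thus ?case
    by (simp add: catalan_def add_ac)
qed

section \<open>Words decomposing as A i B i\<close>

text \<open>If \<open>i < j\<close> both occur twice, the condition forces their copies into the
  order \<open>i j j i\<close> or \<open>j j i i\<close>, whence the name. Letters occurring once
  impose nothing, so prefixes and suffixes inherit the property.\<close>

definition nested_or_decreasing :: "nat list \<Rightarrow> bool" where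
  "nested_or_decreasing w \<longleftrightarrow>
     (\<forall>xs i ys zs. w = xs @ i # ys @ i # zs \<longrightarrow> (\<forall>y\<in>set ys. i < y) \<and> (\<forall>z\<in>set zs. z < i))"

lemma nested_or_decreasingD:
  assumes "nested_or_decreasing (xs @ i # ys @ i # zs)"
  shows "y \<in> set ys \<Longrightarrow> i < y" and "z \<in> set zs \<Longrightarrow> z < i"
  using assms unfolding nested_or_decreasing_def by blast+

lemma nested_or_decreasing_Nil [simp]: "nested_or_decreasing []"
  by (simp add: nested_or_decreasing_def)

lemma nested_or_decreasing_Cons:
  "nested_or_decreasing (x # w) \<longleftrightarrow> nested_or_decreasing w \<and>
     (\<forall>ys zs. w = ys @ x # zs \<longrightarrow> (\<forall>y\<in>set ys. x < y) \<and> (\<forall>z\<in>set zs. z < x))"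
  unfolding nested_or_decreasing_def Cons_eq_append_conv by blast

lemma nested_or_decreasing_appendD:
  assumes "nested_or_decreasing (u @ v)"
  shows "nested_or_decreasing u" and "nested_or_decreasing v"
proof -
  show "nested_or_decreasing v"
    using assms by (induction u) (auto simp: nested_or_decreasing_Cons)
  show "nested_or_decreasing u"
    unfolding nested_or_decreasing_def
  proof (intro allI impI)
    fix xs i ys zs
    assume "u = xs @ i # ys @ i # zs"
    with assms have "nested_or_decreasing (xs @ i # ys @ i # (zs @ v))"
      by simp
    from nested_or_decreasingD[OF this]
    show "(\<forall>y\<in>set ys. i < y) \<and> (\<forall>z\<in>set zs. z < i)"
      by auto
  qed
qed

text \<open>No letter is shared by \<open>u\<close> and \<open>v\<close>, so both copies of a
  repeated letter lie in the same block. For a pair in \<open>u\<close>, appending \<open>v\<close>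
  only adds smaller letters after it.\<close>

lemma nested_or_decreasing_append:
  assumes "nested_or_decreasing u" "nested_or_decreasing v"
    and "\<And>x y. x \<in> set u \<Longrightarrow> y \<in> set v \<Longrightarrow> y < x"
  shows "nested_or_decreasing (u @ v)"
  using assms
proof (induction u)
  case Nil
  thus ?case by simp
next
  case (Cons x u)
  have "(\<forall>y\<in>set ys. x < y) \<and> (\<forall>z\<in>set zs. z < x)" if eq: "u @ v = ys @ x # zs" for ys zs
  proof -
    have "x \<notin> set v"
      using Cons.prems(3)[of x x] by auto
    then obtain zs' where zs': "u = ys @ x # zs'" "zs = zs' @ v"
      using eq by (fastforce simp: append_eq_append_conv2 append_eq_Cons_conv Cons_eq_append_conv)
    have "nested_or_decreasing ([] @ x # ys @ x # zs')"
      using Cons.prems(1) zs' by simp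
    from nested_or_decreasingD[OF this] show ?thesis
      using zs' Cons.prems(3)[of x] by auto
  qed
  thus ?case
    using Cons by (simp add: nested_or_decreasing_Cons)
qed

lemma nested_or_decreasing_enclose:
  assumes "nested_or_decreasing v" "\<And>y. y \<in> set v \<Longrightarrow> i < y"
  shows "nested_or_decreasing (i # v @ [i])"
proof -
  have "nested_or_decreasing (v @ [i])"
    by (rule nested_or_decreasing_append)
      (use assms in \<open>auto simp: nested_or_decreasing_Cons\<close>)
  \<comment> \<open>Since \<open>i\<close> is not in \<open>v\<close>, the closing \<open>i\<close>
    is the only later copy of the opening one.\<close>
  moreover have "ys = v \<and> zs = []" if "v @ [i] = ys @ i # zs" for ys zs
    using that assms(2)[of i]
    by (cases zs rule: rev_cases) auto
  ultimately show ?thesis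
    using assms(2) by (subst nested_or_decreasing_Cons) (metis empty_iff list.set(1))
qed

section \<open>Decomposition and enumeration of the words on an interval of letters\<close>

definition words_on :: "nat \<Rightarrow> nat \<Rightarrow> nat list set" where
  "words_on i j =
     {w. mset w = mset_set {i..<j} + mset_set {i..<j} \<and> nested_or_decreasing w}"

lemma words_onD:
  assumes "w \<in> words_on i j"
  shows "set w = {i..<j}" "mset w = mset_set {i..<j} + mset_set {i..<j}" "nested_or_decreasing w"
proof -
  show *: "mset w = mset_set {i..<j} + mset_set {i..<j}" "nested_or_decreasing w"
    using assms by (auto simp: words_on_def)
  have "set_mset (mset w) = {i..<j}"
    unfolding * by simp
  thus "set w = {i..<j}" by simp
qed

lemma finite_words_on [simp]: "finite (words_on i j)"
proof (rule finite_subset)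
  show "words_on i j \<subseteq> permutations_of_multiset (mset_set {i..<j} + mset_set {i..<j})"
    by (auto simp: words_on_def permutations_of_multiset_def)
qed simp

lemma mset_twice_iff:
  assumes "finite S"
  shows "mset w = mset_set S + mset_set S \<longleftrightarrow> (\<forall>x. count_list w x = (if x \<in> S then 2 else 0))"
  using assms by (auto simp: multiset_eq_iff count_mset count_mset_set')

text \<open>The number \<open>m\<close> is the largest letter of the block \<open>i B i\<close>, and
  all letters of \<open>A\<close> lie above it. Half-open intervals allow \<open>A\<close> or
  \<open>B\<close> to be empty.\<close>

lemma words_on_join:
  assumes "i \<le> m" "m < j" "A \<in> words_on (Suc m) j" "B \<in> words_on (Suc i) (Suc m)"
  shows "A @ i # B @ [i] \<in> words_on i j"
proof -
  note A = words_onD[OF assms(3)] and B = words_onD[OF assms(4)]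
  have "nested_or_decreasing (A @ i # B @ [i])"
    by (rule nested_or_decreasing_append nested_or_decreasing_enclose A B)+
      (use A(1) B(1) assms(1,2) in auto)
  moreover have "mset (A @ i # B @ [i]) = mset_set {i..<j} + mset_set {i..<j}"
  proof (rule multiset_eqI)
    fix x
    show "count (mset (A @ i # B @ [i])) x = count (mset_set {i..<j} + mset_set {i..<j}) x"
      using assms(1,2) by (simp add: A(2) B(2) count_mset_set')
  qed
  ultimately show ?thesis
    by (simp add: words_on_def)
qed

text \<open>The cut is the minimum of the upper set \<open>U\<close>, or \<open>j\<close> if
  \<open>U\<close> is empty.\<close>

lemma initial_segmentE:
  fixes i j :: nat
  assumes "U \<union> V = {i..<j}" "\<And>x y. x \<in> U \<Longrightarrow> y \<in> V \<Longrightarrow> y < x" "i \<le> j"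
  obtains m where "i \<le> m" "m \<le> j" "U = {m..<j}" "V = {i..<m}"
proof (cases "U = {}")
  case True
  with assms(1,3) show thesis
    by (intro that[of j]) auto
next
  case False
  define m where "m = Min U"
  have "finite U"
    using assms(1) by (metis finite_Un finite_atLeastLessThan)
  hence m: "m \<in> U" "\<And>x. x \<in> U \<Longrightarrow> m \<le> x"
    using False by (simp_all add: m_def)
  hence "i \<le> m" "m < j"
    using assms(1) by auto
  have V: "x < m" if "x \<in> V" for x
    using assms(2) m(1) that by blast
  have "x \<in> U \<longleftrightarrow> m \<le> x \<and> x < j" "x \<in> V \<longleftrightarrow> i \<le> x \<and> x < m" for x
  proof -
    have "x \<in> U \<or> x \<in> V \<longleftrightarrow> i \<le> x \<and> x < j"
      using arg_cong[OF assms(1), of "\<lambda>X. x \<in> X"] by simp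
    with m(2)[of x] V[of x] \<open>i \<le> m\<close> \<open>m < j\<close>
    show "x \<in> U \<longleftrightarrow> m \<le> x \<and> x < j" "x \<in> V \<longleftrightarrow> i \<le> x \<and> x < m"
      by linarith+
  qed
  hence "U = {m..<j}" "V = {i..<m}"
    unfolding set_eq_iff atLeastLessThan_iff by blast+
  with \<open>i \<le> m\<close> \<open>m < j\<close> show thesis
    by (intro that[of m]) simp_all
qed

text \<open>The least letter \<open>i\<close> must close the word, as only smaller letters may
  follow its second copy. A letter of \<open>A\<close> has both copies in \<open>A\<close>, since
  otherwise the smaller \<open>i\<close> would lie between them; hence all of \<open>B\<close> comes
  after that pair and is smaller.\<close>

lemma words_on_split:
  assumes "w \<in> words_on i j" "i < j"
  obtains m A B where "i \<le> m" "m < j" "A \<in> words_on (Suc m) j" "B \<in> words_on (Suc i) (Suc m)"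
    "w = A @ i # B @ [i]"
proof -
  note w = words_onD[OF assms(1)]
  have cnt: "count_list w x = (if x \<in> {i..<j} then 2 else 0)" for x
    using w(2) by (simp add: mset_twice_iff)
  have "i \<in> set w"
    using w(1) assms(2) by simp
  then obtain A v where v: "w = A @ i # v" "i \<notin> set A"
    by (meson split_list_first)
  hence "count_list v i = 1"
    using cnt[of i] assms(2) by (simp add: count_list_0_iff)
  hence "i \<in> set v"
    using count_list_0_iff[of v i] by fastforce
  then obtain B C where BC: "v = B @ i # C"
    by (meson split_list)
  have nd: "nested_or_decreasing (A @ i # B @ i # C)"
    using w(3) v BC by simp
  have "C = []"
  proof (rule ccontr)
    assume "C \<noteq> []"
    then obtain z where "z \<in> set C" by (cases C) auto
    with nested_or_decreasingD(2)[OF nd this] w(1) v BC show False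
      by auto
  qed
  have iB: "i \<notin> set B"
    using nested_or_decreasingD(1)[OF nd, of i] by auto
  have w_eq: "w = A @ i # B @ [i]"
    using v BC \<open>C = []\<close> by simp
  have AB: "b < a" if ab: "a \<in> set A" "b \<in> set B" for a b
  proof -
    have a: "i < a" "a < j"
      using w(1) v ab by (auto simp: order_less_le)
    obtain P R where PR: "A = P @ a # R" "a \<notin> set P"
      using ab by (meson split_list_first)
    have "a \<notin> set B"
    proof
      assume "a \<in> set B"
      then obtain B1 B2 where "B = B1 @ a # B2" by (meson split_list)
      hence "nested_or_decreasing (P @ a # (R @ i # B1) @ a # (B2 @ [i]))"
        using w(3) w_eq PR by simp
      from nested_or_decreasingD(1)[OF this, of i] a show False by simp
    qed
    hence "count_list R a = 1"
      using cnt[of a] a w_eq PR by (simp add: count_list_0_iff)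
    hence "a \<in> set R"
      using count_list_0_iff[of R a] by fastforce
    then obtain R1 R2 where "R = R1 @ a # R2" by (meson split_list)
    hence "nested_or_decreasing (P @ a # R1 @ a # (R2 @ i # B @ [i]))"
      using w(3) w_eq PR by simp
    from nested_or_decreasingD(2)[OF this, of b] ab show ?thesis by simp
  qed
  have sets: "set A \<union> set B = {Suc i..<j}"
  proof -
    have "insert i (set A \<union> set B) = {i..<j}"
      using w(1) w_eq by auto
    hence "set A \<union> set B = {i..<j} - {i}"
      using iB v(2) by blast
    moreover have "{i..<j} - {i} = {Suc i..<j}" by auto
    ultimately show ?thesis by simp
  qed
  have "Suc i \<le> j"
    using assms(2) by simp
  obtain m' where m': "Suc i \<le> m'" "m' \<le> j" "set A = {m'..<j}" "set B = {Suc i..<m'}"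
    by (rule initial_segmentE[OF sets AB \<open>Suc i \<le> j\<close>])
  \<comment> \<open>The cut \<open>m'\<close> is the first letter available to \<open>A\<close>; its
    predecessor \<open>m\<close> is the last one of the block \<open>i B i\<close>.\<close>
  then obtain m where m: "m' = Suc m" "i \<le> m" "m < j"
    by (cases m') auto
  \<comment> \<open>The blocks have no common letter, so both copies of each letter fall into one
    block.\<close>
  have "count_list A x = (if x \<in> set A then 2 else 0)"
    "count_list B x = (if x \<in> set B then 2 else 0)" for x
  proof -
    have "\<not> (x \<in> set A \<and> x \<in> set B)"
      using AB less_irrefl by blast
    thus "count_list A x = (if x \<in> set A then 2 else 0)"
      "count_list B x = (if x \<in> set B then 2 else 0)"
      using cnt[of x] w_eq w(1) iB v(2)
      by (auto simp: count_list_0_iff split: if_splits)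
  qed
  hence "mset A = mset_set {Suc m..<j} + mset_set {Suc m..<j}"
    "mset B = mset_set {Suc i..<Suc m} + mset_set {Suc i..<Suc m}"
    using m'(3,4) m(1) by (simp_all add: mset_twice_iff)
  moreover have "nested_or_decreasing A" "nested_or_decreasing B"
    using nested_or_decreasing_appendD[of A "i # B @ [i]"]
      nested_or_decreasing_appendD[of "A @ [i]" "B @ [i]"]
      nested_or_decreasing_appendD[of B "[i]"] w(3) w_eq by simp_all
  ultimately show thesis
    using that[of m A B] m w_eq by (simp add: words_on_def)
qed

text \<open>Splitting and joining are mutually inverse, and both blocks live on shorter intervals,
  so the counts satisfy the Catalan convolution.\<close>

lemma card_words_on: "card (words_on i j) = catalan_rec (j - i)"
proof (induction "j - i" arbitrary: i j rule: less_induct)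
  case less
  show ?case
  proof (cases "i < j")
    case False
    hence "words_on i j = {[]}"
      by (auto simp: words_on_def)
    with False show ?thesis by simp
  next
    case True
    define D where "D = (SIGMA m:{i..<j}. words_on (Suc m) j \<times> words_on (Suc i) (Suc m))"
    define f where "f = (\<lambda>(m::nat, A, B). A @ i # B @ [i])"
    have "words_on i j = f ` D"
    proof (intro equalityI subsetI)
      fix w assume "w \<in> words_on i j"
      then obtain m A B where "i \<le> m" "m < j" "A \<in> words_on (Suc m) j"
        "B \<in> words_on (Suc i) (Suc m)" "w = A @ i # B @ [i]"
        using True by (rule words_on_split)
      thus "w \<in> f ` D"
        by (auto simp: D_def f_def intro!: image_eqI[of _ _ "(m, A, B)"])
    qed (auto simp: D_def f_def intro: words_on_join)
    moreover have "inj_on f D"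
    proof (rule inj_onI)
      fix x y
      assume "x \<in> D" "y \<in> D" "f x = f y"
      obtain m A B m' A' B' where xy: "x = (m, A, B)" "y = (m', A', B')"
        by (metis prod_cases3)
      have D: "(m, A, B) \<in> D" "(m', A', B') \<in> D" and eq: "f (m, A, B) = f (m', A', B')"
        using \<open>x \<in> D\<close> \<open>y \<in> D\<close> \<open>f x = f y\<close> xy by simp_all
      have sets: "set A = {Suc m..<j}" "set B = {Suc i..<Suc m}"
        "set A' = {Suc m'..<j}" "set B' = {Suc i..<Suc m'}"
        using D words_onD(1) by (auto simp: D_def)
      have "i \<notin> set A" "i \<notin> set A'" "i \<notin> set B" "i \<notin> set B'"
        using D sets by (auto simp: D_def)
      \<comment> \<open>The first \<open>i\<close> in the word marks the end of
        \<open>A\<close>.\<close>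
      hence AB: "A = A'" "B = B'"
        using eq by (auto simp: f_def append_Cons_eq_iff)
      have "card (set B) = m - i" "card (set B') = m' - i"
        by (simp_all add: sets)
      with AB D show "x = y"
        by (auto simp: D_def xy)
    qed
    ultimately have "card (words_on i j) = card D"
      by (simp add: card_image)
    also have "\<dots> = (\<Sum>m\<in>{i..<j}. card (words_on (Suc m) j) * card (words_on (Suc i) (Suc m)))"
      by (simp add: D_def card_cartesian_product)
    also have "\<dots> = (\<Sum>m\<in>{i..<j}. catalan_rec (j - Suc m) * catalan_rec (m - i))"
      by (intro sum.cong refl arg_cong2[of _ _ _ _ "(*)"]) (subst less; auto)+
    \<comment> \<open>The new index \<open>k = m - i\<close> is the number of distinct letters in
      \<open>B\<close>.\<close>
    also have "\<dots> = (\<Sum>k\<le>j - Suc i. catalan_rec k * catalan_rec (j - Suc i - k))"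
      by (rule sum.reindex_bij_witness[of _ "\<lambda>k. i + k" "\<lambda>m. m - i"])
        (use True in \<open>auto simp: mult.commute\<close>)
    also have "\<dots> = catalan_rec (Suc (j - Suc i))"
      by simp
    also have "Suc (j - Suc i) = j - i"
      using True by simp
    finally show ?thesis .
  qed
qed

section \<open>Lucky cars\<close>

text \<open>Passing from lucky cars to their preferences preserves the count, because two lucky cars
  cannot share a spot.\<close>

primrec lucky_values :: "nat \<Rightarrow> nat set \<Rightarrow> nat list \<Rightarrow> nat set" where
  "lucky_values m occ [] = {}"
| "lucky_values m occ (p # ps) =
     (if parking_spot m occ p = Some p then {p} else {}) \<union>
     lucky_values m (occ \<union> set_option (parking_spot m occ p)) ps"

lemma lucky_values_subset: "lucky_values m occ ps \<subseteq> set ps"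
  by (induction ps arbitrary: occ) (auto split: if_splits)

lemma lucky_values_disjoint: "lucky_values m occ ps \<inter> occ = {}"
proof (induction ps arbitrary: occ)
  case (Cons p ps)
  \<comment> \<open>A displaced car parks strictly after \<open>p\<close>, so the result
    \<open>Some p\<close> can only mean that \<open>p\<close> was free.\<close>
  have "p \<notin> occ" if "parking_spot m occ p = Some p"
  proof
    assume "p \<in> occ"
    with that have ex: "\<exists>s\<in>{1..m}. p < s \<and> s \<notin> occ"
      and eq: "(LEAST s. s \<in> {1..m} \<and> p < s \<and> s \<notin> occ) = p"
      by (auto simp: parking_spot_def split: if_splits)
    from ex have "\<exists>s. s \<in> {1..m} \<and> p < s \<and> s \<notin> occ" by blast
    from LeastI_ex[OF this] eq show False by simp
  qed
  thus ?case
    using Cons[of "occ \<union> set_option (parking_spot m occ p)"] by auto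
qed simp

lemma card_lucky_park_from:
  "card {i. i < length ps \<and> park_from m occ ps ! i = Some (ps ! i)} = card (lucky_values m occ ps)"
proof (induction ps arbitrary: occ)
  case (Cons p ps)
  define occ' where "occ' = occ \<union> set_option (parking_spot m occ p)"
  define I where "I = {i. i < length ps \<and> park_from m occ' ps ! i = Some (ps ! i)}"
  have "{i. i < length (p # ps) \<and> park_from m occ (p # ps) ! i = Some ((p # ps) ! i)} =
      (if parking_spot m occ p = Some p then {0} else {}) \<union> Suc ` I" (is "?L = ?R")
  proof (rule set_eqI)
    fix k
    show "k \<in> ?L \<longleftrightarrow> k \<in> ?R"
      by (cases k) (auto simp: I_def occ'_def)
  qed
  moreover have "finite I"
    by (simp add: I_def)
  moreover have "finite (lucky_values m occ' ps)"
    using lucky_values_subset finite_set by (rule finite_subset)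
  \<comment> \<open>The spot \<open>p\<close> is now occupied, so the first car contributes a new
    value to the set.\<close>
  moreover have "p \<notin> lucky_values m occ' ps" if "parking_spot m occ p = Some p"
    using lucky_values_disjoint[of m occ' ps] that by (auto simp: occ'_def)
  moreover have "card I = card (lucky_values m occ' ps)"
    unfolding I_def by (rule Cons.IH)
  ultimately show ?case
    by (simp add: card_image card_insert_if image_iff flip: occ'_def)
qed simp

lemma lucky_eq_card_lucky_values: "lucky w = card (lucky_values (length w) {} w)"
  by (simp add: lucky_def parking_outcome_def card_lucky_park_from)

section \<open>A criterion for every value to have a lucky car\<close>

primrec repeats_late :: "nat \<Rightarrow> nat set \<Rightarrow> nat list \<Rightarrow> bool" where
  "repeats_late n S [] \<longleftrightarrow> True"
| "repeats_late n S (p # ps) \<longleftrightarrow>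
     (p \<in> S \<longrightarrow> {p<..n} \<subseteq> S) \<and> repeats_late n (insert p S) ps"

lemma all_splits_Cons:
  "(\<forall>xs p ys. q # w = xs @ p # ys \<longrightarrow> P xs p) \<longleftrightarrow>
     P [] q \<and> (\<forall>xs p ys. w = xs @ p # ys \<longrightarrow> P (q # xs) p)"
  unfolding Cons_eq_append_conv by blast

text \<open>This removes the accumulator \<open>S\<close> in favour of splittings, the form used by
  \<open>nested_or_decreasing\<close>.\<close>

lemma repeats_late_iff:
  "repeats_late n S w \<longleftrightarrow>
     (\<forall>xs p ys. w = xs @ p # ys \<longrightarrow> p \<in> S \<union> set xs \<longrightarrow> {p<..n} \<subseteq> S \<union> set xs)"
proof (induction w arbitrary: S)
  case (Cons q w)
  show ?case
    unfolding all_splits_Cons repeats_late.simps Cons by simp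
qed simp

lemma parking_spot_cases:
  assumes "p \<in> occ"
  obtains "parking_spot m occ p = None" "\<And>s. p < s \<Longrightarrow> s \<le> m \<Longrightarrow> s \<in> occ"
  | s where "parking_spot m occ p = Some s" "p < s" "s \<le> m" "s \<notin> occ"
    "\<And>t. p < t \<Longrightarrow> t < s \<Longrightarrow> t \<in> occ"
proof (cases "\<exists>s\<in>{1..m}. p < s \<and> s \<notin> occ")
  case False
  with assms that(1) show thesis
    by (auto simp: parking_spot_def)
next
  case True
  define s where "s = (LEAST s. s \<in> {1..m} \<and> p < s \<and> s \<notin> occ)"
  have "\<exists>s. s \<in> {1..m} \<and> p < s \<and> s \<notin> occ"
    using True by blast
  from LeastI_ex[OF this] have s: "s \<in> {1..m}" "p < s" "s \<notin> occ"
    by (auto simp: s_def)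
  have "t \<in> occ" if "p < t" "t < s" for t
    using not_less_Least[of t "\<lambda>s. s \<in> {1..m} \<and> p < s \<and> s \<notin> occ"] that s
    by (auto simp: s_def)
  moreover have "parking_spot m occ p = Some s"
    using assms True by (simp add: parking_spot_def s_def)
  ultimately show thesis
    using s that(2) by auto
qed

text \<open>Here \<open>S\<close> is the set of letters already read, and the invariant identifies
  it with the occupied spots up to \<open>n\<close>. A first copy parks luckily and preserves the
  invariant. A repeated letter preserves it exactly when no spot from its value up to
  \<open>n\<close> is free; otherwise it steals a spot and both sides fail.\<close>

lemma all_lucky_iff_repeats_late:
  assumes "n \<le> m" "S \<union> set ps = {1..n}" "occ \<inter> {1..n} = S"
  shows "{1..n} - S \<subseteq> lucky_values m occ ps \<longleftrightarrow> repeats_late n S ps"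
  using assms(2,3)
proof (induction ps arbitrary: S occ)
  case Nil
  thus ?case by auto
next
  case (Cons p ps)
  have p: "p \<in> {1..n}"
    using Cons.prems(1) by auto
  have S': "insert p S \<union> set ps = {1..n}"
    using Cons.prems(1) by auto
  define L where "L = lucky_values m (occ \<union> set_option (parking_spot m occ p)) ps"
  have disj: "L \<inter> (occ \<union> set_option (parking_spot m occ p)) = {}"
    unfolding L_def by (rule lucky_values_disjoint)
  show ?case
  proof (cases "p \<in> S")
    case False
    hence spot: "parking_spot m occ p = Some p"
      using p assms(1) Cons.prems(2) by (auto simp: parking_spot_def)
    have "{1..n} - insert p S \<subseteq> L \<longleftrightarrow> repeats_late n (insert p S) ps"
      unfolding L_def using Cons.prems(2) p by (intro Cons.IH S') (auto simp: spot)
    thus ?thesis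
      using False by (auto simp: spot L_def)
  next
    case True
    hence occ: "p \<in> occ" and ins: "insert p S = S"
      using Cons.prems(2) by auto
    show ?thesis
    proof (cases "{p<..n} \<subseteq> S")
      case sub: True
      \<comment> \<open>All spots from \<open>p\<close> to \<open>n\<close> are taken, so the car
        parks beyond \<open>n\<close> or leaves the street.\<close>
      have spot: "parking_spot m occ p \<noteq> Some p" "set_option (parking_spot m occ p) \<inter> {1..n} = {}"
        using occ by (cases rule: parking_spot_cases[where m = m];
            use sub Cons.prems(2) in force)+
      have "{1..n} - insert p S \<subseteq> L \<longleftrightarrow> repeats_late n (insert p S) ps"
        unfolding L_def using Cons.prems(2) spot p ins by (intro Cons.IH S') auto
      thus ?thesis
        using sub ins spot by (simp add: L_def)
    next
      case False
      then obtain j where j: "p < j" "j \<le> n" "j \<notin> S"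
        by (meson greaterThanAtMost_iff subsetI)
      hence "j \<notin> occ"
        using Cons.prems(2) p by auto
      \<comment> \<open>The spot of the unread letter \<open>j\<close> is still free, so the car
        stops at \<open>j\<close> or earlier.\<close>
      obtain s where s: "parking_spot m occ p = Some s" "p < s" "s \<notin> occ" "s \<le> j"
        using occ
      proof (cases rule: parking_spot_cases[where m = m])
        case 1
        from 1(2)[of j] j \<open>j \<notin> occ\<close> assms(1) show thesis by simp
      next
        case (2 s)
        have "s \<le> j"
          using 2(5)[of j] j \<open>j \<notin> occ\<close> by (meson not_le)
        with 2 show thesis by (intro that)
      qed
      \<comment> \<open>The spot \<open>s\<close> is taken by a car preferring \<open>p < s\<close>,
        so no later car can be lucky there.\<close>
      have "s \<in> {1..n} - S" "s \<notin> L"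
        using s j p disj Cons.prems(2) by auto
      moreover have "lucky_values m occ (p # ps) = L"
        using s by (simp add: L_def)
      ultimately have "\<not> {1..n} - S \<subseteq> lucky_values m occ (p # ps)"
        by blast
      thus ?thesis
        using False True by (simp del: lucky_values.simps)
    qed
  qed
qed

lemma extremely_lucky_iff_repeats_late:
  assumes "w \<in> stirling_permutations n"
  shows "lucky w = n \<longleftrightarrow> repeats_late n {} w"
proof -
  have mset: "mset w = mset_set {1..n} + mset_set {1..n}"
    using assms by (auto simp: stirling_permutations_def permutations_of_multiset_def)
  hence "set_mset (mset w) = {1..n}"
    by simp
  hence set: "set w = {1..n}"
    by simp
  have len: "length w = 2 * n"
    using arg_cong[OF mset, of size] by simp
  have sub: "lucky_values (2 * n) {} w \<subseteq> {1..n}"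
    using lucky_values_subset set by blast
  have "lucky w = n \<longleftrightarrow> lucky_values (2 * n) {} w = {1..n}"
    using card_subset_eq[OF _ sub] by (auto simp: lucky_eq_card_lucky_values len)
  also have "\<dots> \<longleftrightarrow> {1..n} - {} \<subseteq> lucky_values (2 * n) {} w"
    using sub by auto
  also have "\<dots> \<longleftrightarrow> repeats_late n {} w"
    by (rule all_lucky_iff_repeats_late) (use set in auto)
  finally show ?thesis .
qed

section \<open>From Stirling permutations to list splittings\<close>

lemma stirling_condition_iff:
  fixes w :: "nat list"
  shows "(\<forall>a b c. a < b \<and> b < c \<and> c < length w \<and> w ! a = w ! c \<longrightarrow> w ! b > w ! a) \<longleftrightarrow>
         (\<forall>xs i ys zs. w = xs @ i # ys @ i # zs \<longrightarrow> (\<forall>y\<in>set ys. i < y))" (is "?L \<longleftrightarrow> ?R")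
proof
  assume L: ?L
  show ?R
  proof (intro allI impI ballI)
    fix xs i ys zs y
    assume w: "w = xs @ i # ys @ i # zs" and "y \<in> set ys"
    then obtain k where k: "k < length ys" "ys ! k = y"
      by (auto simp: in_set_conv_nth)
    have "w ! length xs = i" "w ! (Suc (length xs) + k) = y"
      "w ! (Suc (length xs) + length ys) = i"
      using k by (simp_all add: w nth_append)
    thus "i < y"
      using L[rule_format, of "length xs" "Suc (length xs) + k" "Suc (length xs) + length ys"] k
      by (simp add: w)
  qed
next
  assume R: ?R
  show ?L
  proof (intro allI impI, elim conjE)
    fix a b c
    assume abc: "a < b" "b < c" "c < length w" "w ! a = w ! c"
    \<comment> \<open>These are the letters strictly between the positions \<open>a\<close> and
      \<open>c\<close>.\<close>
    define ys where "ys = drop (Suc a) (take c w)"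
    have "take c w = take a w @ w ! a # ys"
      using abc id_take_nth_drop[of a "take c w"] by (simp add: ys_def)
    moreover have "w = take c w @ w ! c # drop (Suc c) w"
      using abc id_take_nth_drop[of c w] by simp
    ultimately have "w = take a w @ w ! a # ys @ w ! a # drop (Suc c) w"
      using abc by (metis append.assoc append_Cons)
    moreover have "ys ! (b - Suc a) = w ! b" "b - Suc a < length ys"
      using abc by (simp_all add: ys_def)
    hence "w ! b \<in> set ys"
      by (metis nth_mem)
    ultimately show "w ! a < w ! b"
      using R by blast
  qed
qed

text \<open>If all letters above \<open>i\<close> have appeared before the second \<open>i\<close>,
  one of them occurring again later would enclose that smaller \<open>i\<close>, against the
  Stirling condition. Conversely, if only smaller letters follow the second \<open>i\<close>, all
  larger ones have already appeared.\<close>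

lemma nested_or_decreasing_iff:
  assumes "set w = {1..n}"
  shows "nested_or_decreasing w \<longleftrightarrow>
    (\<forall>xs i ys zs. w = xs @ i # ys @ i # zs \<longrightarrow> (\<forall>y\<in>set ys. i < y)) \<and> repeats_late n {} w"
    (is "_ \<longleftrightarrow> ?S \<and> _")
proof (intro iffI conjI)
  assume nd: "nested_or_decreasing w"
  show ?S
    using nd unfolding nested_or_decreasing_def by blast
  show "repeats_late n {} w"
    unfolding repeats_late_iff
  proof (intro allI impI subsetI)
    fix xs p ys j
    assume w: "w = xs @ p # ys" and "p \<in> {} \<union> set xs" and j: "j \<in> {p<..n}"
    then obtain xs1 xs2 where "xs = xs1 @ p # xs2"
      by (auto dest: split_list)
    hence "nested_or_decreasing (xs1 @ p # xs2 @ p # ys)"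
      using nd w by simp
    from nested_or_decreasingD(2)[OF this, of j] j have "j \<notin> set ys"
      by auto
    moreover have "j \<in> set w"
      using assms j by auto
    ultimately show "j \<in> {} \<union> set xs"
      using w j by auto
  qed
next
  assume "?S \<and> repeats_late n {} w"
  hence S: "\<And>xs i ys zs y. w = xs @ i # ys @ i # zs \<Longrightarrow> y \<in> set ys \<Longrightarrow> i < y"
    and late: "\<And>xs p ys. w = xs @ p # ys \<Longrightarrow> p \<in> set xs \<Longrightarrow> {p<..n} \<subseteq> set xs"
    unfolding repeats_late_iff by (blast, simp)
  show "nested_or_decreasing w"
    unfolding nested_or_decreasing_def
  proof (intro allI impI conjI ballI)
    fix xs i ys zs y
    assume "w = xs @ i # ys @ i # zs" "y \<in> set ys"
    thus "i < y" by (rule S)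
  next
    fix xs i ys zs z
    assume w: "w = xs @ i # ys @ i # zs" and z: "z \<in> set zs"
    obtain zs1 zs2 where zs: "zs = zs1 @ z # zs2"
      using z by (meson split_list)
    show "z < i"
    proof (rule ccontr)
      assume "\<not> z < i"
      moreover have "z \<noteq> i"
      proof
        assume "z = i"
        \<comment> \<open>With a third copy of \<open>i\<close>, the second one would lie between
          equal letters and have to exceed itself.\<close>
        hence "w = xs @ i # (ys @ i # zs1) @ i # zs2"
          using w zs by simp
        from S[OF this, of i] show False by simp
      qed
      moreover have "z \<le> n"
        using assms w z by auto
      ultimately have "z \<in> {i<..n}"
        by simp
      have split: "w = (xs @ i # ys) @ i # zs"
        using w by simp
      have "{i<..n} \<subseteq> set (xs @ i # ys)"
        using late[OF split] by simp
      with \<open>z \<in> {i<..n}\<close> have "z \<in> set (xs @ i # ys)" by blast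
      then obtain us vs where "xs @ i # ys = us @ z # vs"
        by (meson split_list)
      \<comment> \<open>The earlier copy of \<open>z\<close> and the one in \<open>zs\<close>
        enclose the second \<open>i\<close>, although \<open>i < z\<close>.\<close>
      hence "w = us @ z # (vs @ i # zs1) @ z # zs2"
        using split zs by simp
      from S[OF this, of i] \<open>\<not> z < i\<close> show False by simp
    qed
  qed
qed

lemma extremely_lucky_eq_words_on: "extremely_lucky n = words_on 1 (Suc n)"
proof (rule set_eqI)
  fix w
  have "w \<in> extremely_lucky n \<longleftrightarrow> w \<in> stirling_permutations n \<and> repeats_late n {} w"
    unfolding extremely_lucky_def using extremely_lucky_iff_repeats_late by blast
  also have "\<dots> \<longleftrightarrow> mset w = mset_set {1..n} + mset_set {1..n} \<and>
      (\<forall>xs i ys zs. w = xs @ i # ys @ i # zs \<longrightarrow> (\<forall>y\<in>set ys. i < y)) \<and> repeats_late n {} w"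
    unfolding stirling_permutations_def permutations_of_multiset_def mem_Collect_eq
      stirling_condition_iff by blast
  also have "\<dots> \<longleftrightarrow> mset w = mset_set {1..n} + mset_set {1..n} \<and> nested_or_decreasing w"
  proof (rule conj_cong[OF refl])
    assume "mset w = mset_set {1..n} + mset_set {1..n}"
    hence "set_mset (mset w) = {1..n}" by simp
    hence "set w = {1..n}" by simp
    from nested_or_decreasing_iff[OF this]
    show "((\<forall>xs i ys zs. w = xs @ i # ys @ i # zs \<longrightarrow> (\<forall>y\<in>set ys. i < y)) \<and> repeats_late n {} w)
        = nested_or_decreasing w" by blast
  qed
  also have "\<dots> \<longleftrightarrow> w \<in> words_on 1 (Suc n)"
    by (simp add: words_on_def atLeastLessThanSuc_atLeastAtMost)
  finally show "w \<in> extremely_lucky n \<longleftrightarrow> w \<in> words_on 1 (Suc n)" .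
qed

theorem corollary2p16:
  fixes n :: nat
  assumes "n \<ge> 1"
  shows "real (card (extremely_lucky n)) = catalan n"
  by (simp add: extremely_lucky_eq_words_on card_words_on catalan_rec_eq_catalan)

end
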